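(* Let $A\subset\mathbb Z^{d+1}$ be a homogeneous, non-pyramidal configuration of maximal rank $d+1$, of the form $A=\{(1,a'):a'\in A'\}$ with $A'\subset\mathbb Z^d$ a finite configuration whose differences generate $\mathbb Z^d$ as a group, and let $B$ be a Gale dual of $A$. Suppose that $\theta(A)>(m(A)-2)/2$. Then: 1. If $m(A)=2k$ and $\theta(A)=k-1+\ell$, then $\dim L(B)-\dim L(B^{\rm red})\ge 2\ell$. 2. If $m(A)=2k+1$ and $\theta(A)=k-1+\ell$, then $\dim L(B)-\dim L(B^{\rm red})\ge 2\ell-1$.
   Context: Configurations are finite indexed families of not necessarily distinct vectors; $A=\{a_1,\dots,a_n\}$ is identified with the matrix with columns $a_i$. $m(A)=n-d(A)-1$ with $d(A)$ the dimension of the affine span. $A$ is homogeneous if $(1,\dots,1)$ lies in the rational row span of the matrix; it is a pyramid if some affine hyperplane contains all points of $A$ except one (equivalently, some $a_i$ is not in the affine span of the others), and non-pyramidal otherwise. Gale dual: $B=\{b_1,\dots,b_n\}\subset\mathbb Q^{m(A)}$, the rows of a matrix whose columns are a basis of $\ker_{\mathbb Q}(A)$. $L(\cdot)$ is $\mathbb Q$-linear span, $\mathfrak s(C)=\sum_{b\in C}b$, and $C$ is dual-homogeneous if $\mathfrak s(C)=0$. Cayley decomposition of $B$ of length $r\ge0$: a partition $B=B_0\cup\dots\cup B_r$ into nonempty dual-homogeneous subconfigurations; $c(B_0,\dots,B_r)=\sum_j\dim L(B_j)-\dim L(B)$; $\theta(A)=\theta(B)$ is the maximum of $r-c(B_0,\dots,B_r)$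 over all Cayley decompositions of $B$. Reduction: a rank-one flat of $B$ is a subfamily $F=\{b\in B: b\in\Lambda\}$ spanning a line $\Lambda$; it is splitting if $\mathfrak s(F)=0$ and non-splitting otherwise. $B^{\rm red}$ is the configuration consisting of one vector $\mathfrak s(F)$ for each non-splitting rank-one flat $F$ of $B$ (elements in splitting rank-one flats are discarded). *)

theory Defs
  imports
    "HOL-Analysis.Analysis"
    "HOL-Library.Disjoint_Sets"
    "HOL-Computational_Algebra.Group_Closure"
begin

text \<open>
  A configuration of vectors, not necessarily distinct, is a family \<open>v :: 'n \<Rightarrow> rat ^ 'k\<close>
  over a finite index type; a subconfiguration is given by its set of indices. All linear and
  affine notions are taken over the rationals. The constants \<open>vec.span\<close>, \<open>vec.dim\<close>,
  \<open>rank\<close> are the library's, for coordinate spaces over an arbitrary field.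
\<close>

definition rat_config :: "('n \<Rightarrow> int ^ 'k) \<Rightarrow> 'n \<Rightarrow> rat ^ 'k" where
  "rat_config a j = (\<chi> i. of_int (a j $ i))"

text \<open>The matrix whose columns are the vectors of the configuration.\<close>

definition config_matrix :: "('n \<Rightarrow> rat ^ 'k) \<Rightarrow> rat ^ 'n ^ 'k" where
  "config_matrix v = (\<chi> i j. v j $ i)"

definition homogeneous :: "('n::finite \<Rightarrow> rat ^ 'k::finite) \<Rightarrow> bool" where
  "homogeneous v \<longleftrightarrow> (\<chi> j. 1) \<in> vec.span (rows (config_matrix v))"

text \<open>The library's \<open>affine\<close> is restricted to real vector spaces.\<close>

definition rat_affine :: "(rat ^ 'k::finite) set \<Rightarrow> bool" where
  "rat_affine V \<longleftrightarrow>
     (\<forall>x\<in>V. \<forall>y\<in>V. \<forall>s t. s + t = 1 \<longrightarrow> s *s x + t *s y \<in> V)"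

text \<open>The dimension of a nonempty affine subspace is that of its space of differences.\<close>

definition affine_span_dim :: "('n::finite \<Rightarrow> rat ^ 'k::finite) \<Rightarrow> nat" where
  "affine_span_dim v =
     vec.dim {x - y | x y. x \<in> rat_affine hull (range v) \<and> y \<in> rat_affine hull (range v)}"

definition m_config :: "('n::finite \<Rightarrow> rat ^ 'k::finite) \<Rightarrow> int" where
  "m_config v = int CARD('n) - int (affine_span_dim v) - 1"

definition affine_hyperplane :: "(rat ^ 'k::finite) set \<Rightarrow> bool" where
  "affine_hyperplane H \<longleftrightarrow> (\<exists>c t. c \<noteq> 0 \<and> H = {x. (\<Sum>i\<in>UNIV. c $ i * x $ i) = t})"

definition pyramid :: "('n::finite \<Rightarrow> rat ^ 'k::finite) \<Rightarrow> bool" where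
  "pyramid v \<longleftrightarrow> (\<exists>H j. affine_hyperplane H \<and> v j \<notin> H \<and> (\<forall>i. i \<noteq> j \<longrightarrow> v i \<in> H))"

text \<open>The vectors \<open>b j\<close> are the rows of a matrix whose columns, listed without
  repetition, form a basis of the kernel.\<close>

definition gale_dual ::
    "('n::finite \<Rightarrow> rat ^ 'k::finite) \<Rightarrow> ('n \<Rightarrow> rat ^ 'm::finite) \<Rightarrow> bool" where
  "gale_dual v b \<longleftrightarrow>
     int CARD('m) = m_config v \<and>
     inj (\<lambda>i. column i (\<chi> j. b j)) \<and>
     vec.independent (columns (\<chi> j. b j)) \<and>
     vec.span (columns (\<chi> j. b j)) = {x. config_matrix v *v x = 0}"

text \<open>The index type and the index set are arbitrary here, so that the next definition also
  applies to the reduction, a family indexed by flats.\<close>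

definition lin_dim :: "('i \<Rightarrow> rat ^ 'm::finite) \<Rightarrow> 'i set \<Rightarrow> nat" where
  "lin_dim v I = vec.dim (vec.span (v ` I))"

definition config_sum :: "('n \<Rightarrow> rat ^ 'm::finite) \<Rightarrow> 'n set \<Rightarrow> rat ^ 'm" where
  "config_sum b I = (\<Sum>j\<in>I. b j)"

definition dual_homogeneous :: "('n \<Rightarrow> rat ^ 'm::finite) \<Rightarrow> 'n set \<Rightarrow> bool" where
  "dual_homogeneous b I \<longleftrightarrow> config_sum b I = 0"

text \<open>A decomposition with parts \<open>B\<^sub>0, \<dots>, B\<^sub>r\<close> is a partition of the index set
  (\<open>partition_on\<close> includes that the parts are nonempty), so its length \<open>r\<close> is the number of
  parts minus one.\<close>

definition cayley_decomposition ::
    "('n::finite \<Rightarrow> rat ^ 'm::finite) \<Rightarrow> 'n set set \<Rightarrow> bool" where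
  "cayley_decomposition b P \<longleftrightarrow> partition_on UNIV P \<and> (\<forall>I\<in>P. dual_homogeneous b I)"

definition cayley_length :: "'n set set \<Rightarrow> int" where
  "cayley_length P = int (card P) - 1"

definition cayley_c :: "('n::finite \<Rightarrow> rat ^ 'm::finite) \<Rightarrow> 'n set set \<Rightarrow> int" where
  "cayley_c b P = (\<Sum>I\<in>P. int (lin_dim b I)) - int (lin_dim b UNIV)"

text \<open>The set below is finite, and it is nonempty when \<open>b\<close> is dual-homogeneous (take the
  partition with one part), in particular for a Gale dual of a homogeneous configuration.\<close>

definition theta :: "('n::finite \<Rightarrow> rat ^ 'm::finite) \<Rightarrow> int" where
  "theta b = Max {cayley_length P - cayley_c b P | P. cayley_decomposition b P}"

definition rank_one_flat :: "('n::finite \<Rightarrow> rat ^ 'm::finite) \<Rightarrow> 'n set \<Rightarrow> bool" where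
  "rank_one_flat b F \<longleftrightarrow>
     (\<exists>L. vec.subspace L \<and> vec.dim L = 1 \<and> F = {j. b j \<in> L} \<and> vec.span (b ` F) = L)"

definition splitting :: "('n::finite \<Rightarrow> rat ^ 'm::finite) \<Rightarrow> 'n set \<Rightarrow> bool" where
  "splitting b F \<longleftrightarrow> config_sum b F = 0"

definition nonsplitting_flats :: "('n::finite \<Rightarrow> rat ^ 'm::finite) \<Rightarrow> 'n set set" where
  "nonsplitting_flats b = {F. rank_one_flat b F \<and> \<not> splitting b F}"

text \<open>The reduction of \<open>b\<close> is the family \<open>config_sum b\<close> indexed by
  \<open>nonsplitting_flats b\<close>.\<close>

definition lin_dim_red :: "('n::finite \<Rightarrow> rat ^ 'm::finite) \<Rightarrow> nat" where
  "lin_dim_red b = lin_dim (config_sum b) (nonsplitting_flats b)"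

text \<open>\<open>'k\<close> indexes the \<open>d + 1\<close> coordinates and \<open>i0\<close> plays the role of the first one, so the
  vectors with vanishing \<open>i0\<close>-coordinate are a copy of \<open>\<int>\<^sup>d\<close> (also for \<open>d = 0\<close>). They contain the
  differences of the points \<open>(1, a')\<close>, which are those of the points \<open>a'\<close>.\<close>

definition lattice_form :: "'k::finite \<Rightarrow> ('n::finite \<Rightarrow> int ^ 'k) \<Rightarrow> bool" where
  "lattice_form i0 a \<longleftrightarrow>
     (\<forall>j. a j $ i0 = 1) \<and>
     group_closure {a i - a j | i j. True} = {z. z $ i0 = 0}"

end

theory Submission
  imports Defs
begin

text \<open>
  Write \<open>\<delta>(I)\<close> for the dimension of the span of a part \<open>I\<close>, and \<open>D = dim L(B) \<le> m\<close>. Then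
  \<open>r - c = D - 1 - \<Sum>\<^sub>I (\<delta>(I) - 1)\<close>, so the defect \<open>\<Sum>\<^sub>I (\<delta>(I) - 1)\<close> of a decomposition
  attaining \<open>\<theta>\<close> equals \<open>D - 1 - \<theta>\<close>. In both parities of \<open>m\<close> the bound claimed is
  \<open>D - dim L(B\<^sup>r\<^sup>e\<^sup>d) \<ge> 2\<theta> + 2 - m\<close>, and because of \<open>D \<le> m\<close> it is enough that
  \<open>dim L(B\<^sup>r\<^sup>e\<^sup>d)\<close> is at most twice the defect of any Cayley decomposition
  (\<open>lin_dim_red_le_twice_defect\<close>).

  The reason for this is that the parts spanning a line are invisible in the reduction. Such a
  part lies inside a given rank-one flat \<open>F\<close> or is disjoint from it, and since it sums to zero it
  contributes nothing to \<open>\<ss>(F)\<close> either way. So \<open>\<ss>(F)\<close> is a sum of vectors from parts with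
  \<open>\<delta>(I) \<ge> 2\<close> (\<open>flat_sum_in_span_of_higher_parts\<close>), and \<open>dim L(B\<^sup>r\<^sup>e\<^sup>d)\<close> is at most the sum of \<open>\<delta>(I)\<close> over these parts, where
  \<open>\<delta>(I) \<le> 2 (\<delta>(I) - 1)\<close>. Parts with \<open>\<delta>(I) = 0\<close> would contribute \<open>-1\<close> to the defect and spoil the
  bound; they are excluded because the Gale dual of a non-pyramid has no zero vectors
  (\<open>gale_dual_nonzero\<close>). The Gale
  dual sums to zero because \<open>(1, \<dots>, 1)\<close> is a row of the matrix of \<open>A\<close>, so a decomposition attaining
  \<open>\<theta>\<close> exists (\<open>theta_attained\<close>).
\<close>

section \<open>The reduction and the defect of a Cayley decomposition\<close>

lemma dim_UN_le_sum:
  fixes S :: "'i \<Rightarrow> (rat ^ 'm::finite) set"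
  assumes "finite Q"
  shows "vec.dim (\<Union>I\<in>Q. S I) \<le> (\<Sum>I\<in>Q. vec.dim (S I))"
proof -
  have "\<forall>I. \<exists>C. C \<subseteq> S I \<and> vec.independent C \<and> S I \<subseteq> vec.span C \<and> card C = vec.dim (S I)"
    by (metis vec.basis_exists)
  then obtain C where C: "\<And>I. C I \<subseteq> S I" "\<And>I. vec.independent (C I)"
      "\<And>I. S I \<subseteq> vec.span (C I)" "\<And>I. card (C I) = vec.dim (S I)"
    by metis
  have fin: "finite (\<Union>I\<in>Q. C I)"
    using assms C(2) vec.finiteI_independent by blast
  have "(\<Union>I\<in>Q. S I) \<subseteq> vec.span (\<Union>I\<in>Q. C I)"
  proof (rule UN_least)
    fix I assume "I \<in> Q"
    then have "vec.span (C I) \<subseteq> vec.span (\<Union>I\<in>Q. C I)"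
      by (intro vec.span_mono) blast
    with C(3) show "S I \<subseteq> vec.span (\<Union>I\<in>Q. C I)" by blast
  qed
  then have "vec.dim (\<Union>I\<in>Q. S I) \<le> card (\<Union>I\<in>Q. C I)"
    using fin by (rule vec.dim_le_card)
  also have "\<dots> \<le> (\<Sum>I\<in>Q. card (C I))"
    using assms by (rule card_UN_le)
  finally show ?thesis
    by (simp add: C(4))
qed

lemma lin_dim_pos:
  fixes b :: "'n \<Rightarrow> rat ^ 'm::finite"
  assumes "j \<in> I" "b j \<noteq> 0"
  shows "lin_dim b I \<ge> 1"
proof -
  have "vec.dim (b ` I) \<noteq> 0"
    using assms by (auto simp: vec.dim_eq_0)
  then show ?thesis
    unfolding lin_dim_def vec.dim_span by linarith
qed

text \<open>A nonzero vector of a part that spans a line already spans that line.\<close>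

lemma collinear_part_subset:
  fixes b :: "'n \<Rightarrow> rat ^ 'm::finite"
  assumes L: "vec.subspace L" and one: "lin_dim b I = 1"
    and j: "j \<in> I" "b j \<in> L" "b j \<noteq> 0" and i: "i \<in> I"
  shows "b i \<in> L"
proof -
  have "vec.span {b j} = vec.span (b ` I)"
  proof (rule vec.dim_eq_span)
    show "{b j} \<subseteq> b ` I" using j by blast
    have "vec.independent {b j}"
      using j(3) by (simp add: vec.dependent_single)
    then have "vec.dim {b j} = 1"
      using vec.dim_eq_card_independent by fastforce
    with one show "vec.dim (b ` I) \<le> vec.dim {b j}"
      by (simp add: lin_dim_def vec.dim_span)
  qed
  moreover have "b i \<in> vec.span (b ` I)"
    using i by (simp add: vec.span_base)
  moreover have "vec.span {b j} \<subseteq> L"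
    using L j(2) by (simp add: vec.span_minimal)
  ultimately show ?thesis by blast
qed

lemma flat_sum_in_span_of_higher_parts:
  fixes b :: "'n::finite \<Rightarrow> rat ^ 'm::finite"
  assumes nz: "\<And>j. b j \<noteq> 0" and P: "cayley_decomposition b P"
    and F: "rank_one_flat b F"
  shows "config_sum b F \<in> vec.span (\<Union>I\<in>{I\<in>P. lin_dim b I \<ge> 2}. b ` I)"
    (is "_ \<in> vec.span ?U")
proof -
  obtain L where L: "vec.subspace L" and FL: "F = {j. b j \<in> L}"
    using F unfolding rank_one_flat_def by blast
  have part: "partition_on UNIV P" and zero: "\<And>I. I \<in> P \<Longrightarrow> (\<Sum>j\<in>I. b j) = 0"
    using P by (auto simp: cayley_decomposition_def dual_homogeneous_def config_sum_def)
  have "F = (\<Union>I\<in>P. F \<inter> I)"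
    using partition_onD1[OF part] by blast
  then have "config_sum b F = sum b (\<Union>I\<in>P. F \<inter> I)"
    unfolding config_sum_def by simp
  also have "\<dots> = (\<Sum>I\<in>P. \<Sum>j\<in>F \<inter> I. b j)"
    using partition_onD2[OF part]
    by (intro sum.UNION_disjoint) (auto simp: disjoint_def)
  finally have eq: "config_sum b F = (\<Sum>I\<in>P. \<Sum>j\<in>F \<inter> I. b j)" .
  have "(\<Sum>j\<in>F \<inter> I. b j) \<in> vec.span ?U" if I: "I \<in> P" for I
  proof (cases "lin_dim b I \<ge> 2")
    case True
    then have "b j \<in> ?U" if "j \<in> F \<inter> I" for j
      using I that by blast
    then show ?thesis
      by (intro vec.span_sum vec.span_base)
  next
    case False
    obtain i where "i \<in> I"
      using partition_onD3[OF part] I by (metis all_not_in_conv)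
    with lin_dim_pos[of i I b] nz have "lin_dim b I \<ge> 1" by blast
    with False have "lin_dim b I = 1" by linarith
    then have "F \<inter> I = {} \<or> F \<inter> I = I"
      using collinear_part_subset[OF L, of b I] nz by (auto simp: FL)
    with zero[OF I] show ?thesis
      by (auto simp: vec.span_zero)
  qed
  then show ?thesis
    unfolding eq by (rule vec.span_sum)
qed

lemma lin_dim_red_le_twice_defect:
  fixes b :: "'n::finite \<Rightarrow> rat ^ 'm::finite"
  assumes nz: "\<And>j. b j \<noteq> 0" and P: "cayley_decomposition b P"
  shows "int (lin_dim_red b) \<le> 2 * (\<Sum>I\<in>P. int (lin_dim b I) - 1)"
proof -
  let ?Q = "{I\<in>P. lin_dim b I \<ge> 2}"
  let ?U = "\<Union>I\<in>?Q. b ` I"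
  have "config_sum b ` nonsplitting_flats b \<subseteq> vec.span ?U"
    using flat_sum_in_span_of_higher_parts[OF nz P] by (auto simp: nonsplitting_flats_def)
  then have "lin_dim_red b \<le> vec.dim ?U"
    unfolding lin_dim_red_def lin_dim_def vec.dim_span by (rule vec.dim_mono)
  also have "\<dots> \<le> (\<Sum>I\<in>?Q. lin_dim b I)"
    using dim_UN_le_sum[of ?Q "\<lambda>I. b ` I"] by (simp add: lin_dim_def vec.dim_span)
  finally have "int (lin_dim_red b) \<le> (\<Sum>I\<in>?Q. int (lin_dim b I))"
    by (metis of_nat_le_iff of_nat_sum)
  also have "\<dots> \<le> (\<Sum>I\<in>?Q. 2 * (int (lin_dim b I) - 1))"
    by (rule sum_mono) auto
  also have "\<dots> \<le> (\<Sum>I\<in>P. 2 * (int (lin_dim b I) - 1))"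
  proof (rule sum_mono2)
    fix I assume "I \<in> P - ?Q"
    then obtain i where "i \<in> I"
      using P partition_onD3 unfolding cayley_decomposition_def
      by (metis DiffD1 all_not_in_conv)
    with lin_dim_pos[of i I b] nz show "0 \<le> 2 * (int (lin_dim b I) - 1)" by force
  qed auto
  finally show ?thesis
    by (simp add: sum_distrib_left)
qed

text \<open>The one-part partition is a Cayley decomposition exactly when the whole family sums to zero;
  it witnesses that the maximum defining \<open>\<theta>\<close> is over a nonempty set.\<close>

lemma theta_attained:
  fixes b :: "'n::finite \<Rightarrow> rat ^ 'm::finite"
  assumes "config_sum b UNIV = 0"
  obtains P where "cayley_decomposition b P"
    "theta b = int (lin_dim b UNIV) - 1 - (\<Sum>I\<in>P. int (lin_dim b I) - 1)"
proof -
  let ?T = "{cayley_length P - cayley_c b P | P. cayley_decomposition b P}"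
  have "cayley_decomposition b {UNIV}"
    using assms by (simp add: cayley_decomposition_def dual_homogeneous_def partition_on_def)
  then have "?T \<noteq> {}" by blast
  moreover have "finite ?T"
    by (rule finite_subset[of _ "range (\<lambda>P. cayley_length P - cayley_c b P)"]) auto
  ultimately have "theta b \<in> ?T"
    unfolding theta_def by (rule Max_in[rotated])
  then obtain P where P: "cayley_decomposition b P"
      and "theta b = cayley_length P - cayley_c b P"
    by blast
  then have "theta b = int (lin_dim b UNIV) - 1 - (\<Sum>I\<in>P. int (lin_dim b I) - 1)"
    by (simp add: cayley_length_def cayley_c_def sum_subtractf)
  with P show ?thesis by (rule that)
qed

section \<open>Gale duals of homogeneous and non-pyramidal configurations\<close>

lemma gale_dual_column_in_kernel:
  fixes v :: "'n::finite \<Rightarrow> rat ^ 'k::finite" and b :: "'n \<Rightarrow> rat ^ 'm::finite"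
  assumes "gale_dual v b"
  shows "config_matrix v *v (\<chi> j. b j $ i) = 0"
proof -
  have "(\<chi> j. b j $ i) \<in> columns (\<chi> j. b j)"
    by (auto simp: columns_def column_def)
  then have "(\<chi> j. b j $ i) \<in> vec.span (columns (\<chi> j. b j))"
    by (rule vec.span_base)
  with assms show ?thesis
    by (auto simp: gale_dual_def)
qed

lemma gale_dual_sum_zero:
  fixes v :: "'n::finite \<Rightarrow> rat ^ 'k::finite" and b :: "'n \<Rightarrow> rat ^ 'm::finite"
  assumes "gale_dual v b" and "\<And>j. v j $ i0 = 1"
  shows "config_sum b UNIV = 0"
proof -
  have "(\<Sum>j\<in>UNIV. b j $ i) = 0" for i
  proof -
    have "(config_matrix v *v (\<chi> j. b j $ i)) $ i0 = 0"
      by (simp add: gale_dual_column_in_kernel[OF assms(1)])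
    then show ?thesis
      by (simp add: matrix_vector_mult_def config_matrix_def assms(2))
  qed
  then show ?thesis
    by (simp add: config_sum_def vec_eq_iff)
qed

lemma separating_functional:
  fixes W :: "(rat ^ 'k::finite) set"
  assumes "x \<notin> vec.span W"
  obtains c where "\<And>w. w \<in> W \<Longrightarrow> (\<Sum>i\<in>UNIV. c $ i * w $ i) = 0"
    "(\<Sum>i\<in>UNIV. c $ i * x $ i) = 1"
proof -
  obtain C where C: "C \<subseteq> W" "vec.independent C" "W \<subseteq> vec.span C"
    by (metis vec.basis_exists)
  have xC: "x \<notin> vec.span C"
    using assms C(1) vec.span_mono by blast
  then have "vec.independent (insert x C)"
    using C(2) by (simp add: vec.independent_insert)
  then obtain g :: "rat ^ 'k \<Rightarrow> rat ^ 'k" where g: "Vector_Spaces.linear (*s) (*s) g"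
      and val: "\<forall>y\<in>insert x C. g y = (if y = x then 1 else 0)"
    using vec.linear_independent_extend[of "insert x C" "\<lambda>y. if y = x then 1 else 0"] by blast
  have 0: "g y = 0" if "y \<in> vec.span C" for y
  proof (rule vec.linear_eq_0_on_span[OF g _ that])
    fix z assume z: "z \<in> C"
    then have "z \<noteq> x" using xC vec.span_base by blast
    with z val show "g z = 0" by simp
  qed
  \<comment> \<open>Every coordinate of \<open>g\<close> is such a functional.\<close>
  define c where "c = row undefined (matrix g)"
  have c: "(\<Sum>i\<in>UNIV. c $ i * y $ i) = g y $ undefined" for y
  proof -
    have "g y = matrix g *v y" by (metis g matrix_works)
    then show ?thesis
      by (simp add: c_def row_def matrix_vector_mult_def)
  qed
  show ?thesis
  proof (rule that)
    fix w assume "w \<in> W"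
    then have "g w = 0" using 0 C(3) by blast
    then show "(\<Sum>i\<in>UNIV. c $ i * w $ i) = 0" by (simp add: c)
  next
    show "(\<Sum>i\<in>UNIV. c $ i * x $ i) = 1"
      unfolding c using val by simp
  qed
qed

text \<open>If \<open>b\<^sub>j = 0\<close>, every linear relation among the vectors of \<open>A\<close> omits \<open>a\<^sub>j\<close>, so \<open>a\<^sub>j\<close> is not in
  the span of the others and some linear functional separates it from them.\<close>

lemma gale_dual_nonzero:
  fixes v :: "'n::finite \<Rightarrow> rat ^ 'k::finite" and b :: "'n \<Rightarrow> rat ^ 'm::finite"
  assumes gd: "gale_dual v b" and np: "\<not> pyramid v"
  shows "b j \<noteq> 0"
proof
  assume bj: "b j = 0"
  have ker: "x $ j = 0" if "config_matrix v *v x = 0" for x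
  proof -
    have "x \<in> vec.span (columns (\<chi> j. b j))"
      using gd that by (auto simp: gale_dual_def)
    moreover have "vec.span (columns (\<chi> j. b j)) \<subseteq> {x. x $ j = 0}"
      by (rule vec.span_minimal) (auto simp: columns_def column_def bj vec.subspace_def)
    ultimately show ?thesis by blast
  qed
  have col: "config_matrix v *v axis i 1 = v i" for i
    by (auto simp: axis_def matrix_vector_mult_def config_matrix_def vec_eq_iff
        if_distrib cong: if_cong)
  have "v j \<notin> vec.span (v ` (- {j}))"
  proof
    assume "v j \<in> vec.span (v ` (- {j}))"
    moreover have "vec.span (v ` (- {j})) \<subseteq> (*v) (config_matrix v) ` {x. x $ j = 0}"
    proof (rule vec.span_minimal)
      have "v i \<in> (*v) (config_matrix v) ` {x. x $ j = 0}" if "i \<noteq> j" for i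
      proof (rule image_eqI)
        show "v i = config_matrix v *v axis i 1" by (simp add: col)
      qed (use that in \<open>simp add: axis_def\<close>)
      then show "v ` (- {j}) \<subseteq> (*v) (config_matrix v) ` {x. x $ j = 0}" by blast
      have "vec.subspace {x :: rat ^ 'n. x $ j = 0}"
        by (simp add: vec.subspace_def)
      then show "vec.subspace ((*v) (config_matrix v) ` {x. x $ j = 0})"
        by (intro vec.linear_subspace_image matrix_vector_mul_linear_gen)
    qed
    ultimately obtain x where x: "x $ j = 0" "config_matrix v *v x = v j" by auto
    then have "config_matrix v *v (axis j 1 - x) = 0"
      by (simp add: matrix_vector_mult_diff_distrib col)
    from ker[OF this] x show False by (simp add: axis_def)
  qed
  then obtain c where c: "\<And>w. w \<in> v ` (- {j}) \<Longrightarrow> (\<Sum>i\<in>UNIV. c $ i * w $ i) = 0"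
      "(\<Sum>i\<in>UNIV. c $ i * v j $ i) = 1"
    using separating_functional by blast
  have "c \<noteq> 0"
    using c(2) by auto
  then have "affine_hyperplane {x. (\<Sum>i\<in>UNIV. c $ i * x $ i) = 0}"
    unfolding affine_hyperplane_def by blast
  moreover have "v j \<notin> {x. (\<Sum>i\<in>UNIV. c $ i * x $ i) = 0}"
    using c(2) by simp
  moreover have "\<forall>i. i \<noteq> j \<longrightarrow> v i \<in> {x. (\<Sum>i\<in>UNIV. c $ i * x $ i) = 0}"
    using c(1) by blast
  ultimately have "pyramid v"
    unfolding pyramid_def by blast
  with np show False ..
qed

section \<open>Large \<open>\<theta>\<close> forces a small reduction\<close>

theorem proposition4p21:
  fixes a :: "'n::finite \<Rightarrow> int ^ 'k::finite"
    and b :: "'n \<Rightarrow> rat ^ 'm::finite"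
    and i0 :: 'k
    and d :: nat
  assumes dim: "CARD('k) = d + 1"
    and "homogeneous (rat_config a)"
    and "\<not> pyramid (rat_config a)"
    and "rank (config_matrix (rat_config a)) = d + 1"
    and "lattice_form i0 a"
    and "gale_dual (rat_config a) b"
    and "real_of_int (theta b) > (real_of_int (m_config (rat_config a)) - 2) / 2"
  shows "(\<forall>k l :: int. m_config (rat_config a) = 2 * k \<and> theta b = k - 1 + l \<longrightarrow>
            int (lin_dim b UNIV) - int (lin_dim_red b) \<ge> 2 * l) \<and>
         (\<forall>k l :: int. m_config (rat_config a) = 2 * k + 1 \<and> theta b = k - 1 + l \<longrightarrow>
            int (lin_dim b UNIV) - int (lin_dim_red b) \<ge> 2 * l - 1)"
proof -
  have nz: "\<And>j. b j \<noteq> 0"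
    using gale_dual_nonzero assms by blast
  have "rat_config a j $ i0 = 1" for j
    using \<open>lattice_form i0 a\<close> by (simp add: lattice_form_def rat_config_def)
  then have "config_sum b UNIV = 0"
    using gale_dual_sum_zero assms by blast
  then obtain P where P: "cayley_decomposition b P"
      and th: "theta b = int (lin_dim b UNIV) - 1 - (\<Sum>I\<in>P. int (lin_dim b I) - 1)"
    by (rule theta_attained)
  have m: "m_config (rat_config a) = int CARD('m)"
    using \<open>gale_dual (rat_config a) b\<close> by (simp add: gale_dual_def)
  have "vec.dim (b ` UNIV) \<le> CARD('m)"
    by (rule dim_subset_UNIV_cart_gen)
  then have "int (lin_dim b UNIV) \<le> m_config (rat_config a)"
    by (simp add: m lin_dim_def vec.dim_span)
  with lin_dim_red_le_twice_defect[OF nz P] th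
  have "int (lin_dim b UNIV) - int (lin_dim_red b) \<ge> 2 * theta b + 2 - m_config (rat_config a)"
    by linarith
  then show ?thesis by auto
qed

end
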